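(* Let $(G,m,u,\iota)$ be a group object in a Cartesian tangent category $\mathbb X$ such that the pullback $T(G)_u$ of $p_G:T(G)\to G$ along $u:1\to G$ exists. Then the set of left-invariant vector fields $\xi:G\to T(G)$ is isomorphic to (in bijection with) the set of elements $V:1\to T(G)_u$ of $T(G)_u$.
   Context: Composition is written in diagrammatic order: $fg$ means first $f$, then $g$. Tangent category $(\mathbb X,T,p,0,+,\ell,c)$: a category $\mathbb X$ with a functor $T:\mathbb X\to\mathbb X$ and a natural transformation $p:T\to 1$ such that the pullback powers $T_n(M)$ of $p_M$ ($n$-fold fibre products of $T(M)$ over $M$) exist for all objects $M$ and are preserved by $T$; natural transformations $+:T_2\to T$, $0:1\to T$ making each $p_M$ an additive bundle (a commutative monoid over $M$: $+p=\pi_0p=\pi_1p$, $0p=1$, $+$ associative, commutative, with unit $0$); a natural transformation $\ell:T\to T^2$ such that $(\ell_M,0_M):(p_M,+_M,0_M)\to(T(p_M),T(+_M),T(0_M))$ is an additive bundle morphism (commutes with projections, additions and zeros); a natural transformation $c:T^2\to T^2$ with $c^2=1$, $\ell c=\ell$ such that $(c_M,1):(T(p_M),T(+_M),T(0_M))\to(p_{TM},+_{TM},0_{TM})$ is an additive bundle morphism; such that $\ell T(\ell)=\ell\,\ell_T$, $T(c)\,c_T\,T(c)=c_T\,T(c)\,c_T$, $\ell_T\,T(c)\,c_T=c\,T(\ell)$, and $\langle\pi_0\ell,\pi_1 0_T\rangle T(+):T_2M\to T^2M$ is the equalizer of $T(p)$ and $T(p)p0:T^2M\to TM$. Cartesian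 tangent category: a tangent category with all finite products (terminal object $1$) such that the product functor, with the natural isomorphism $T(A)\times T(B)\cong T(A\times B)$, is a strong morphism of tangent categories (the canonical comparison maps are isomorphisms compatible with $p,0,+,\ell,c$; in particular $0_1:1\to T(1)$ is an isomorphism). These identifications are suppressed, so e.g. $T(m):T(G)\times T(G)\to T(G)$. A group object has multiplication $m:G\times G\to G$, unit $u:1\to G$, inversion $\iota:G\to G$. A left-invariant vector field is a morphism $\xi:G\to T(G)$ with $\xi p=1_G$ and $(0\times\xi)T(m)=m\xi:G\times G\to T(G)$. An element of an object $A$ is a morphism $1\to A$. *)

theory Defs
  imports Main
begin

section \<open>Categories, in diagrammatic order\<close>

text \<open>\<open>f \<cdot> g\<close> means first \<open>f\<close>, then \<open>g\<close>. Nothing is assumed about composites of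
  non-composable arrows.\<close>

record ('o, 'm) category_data =
  Ob :: "'o set"
  Ar :: "'m set"
  Dom :: "'m \<Rightarrow> 'o"
  Cod :: "'m \<Rightarrow> 'o"
  Id :: "'o \<Rightarrow> 'm"
  Comp :: "'m \<Rightarrow> 'm \<Rightarrow> 'm"  (infixl \<open>\<cdot>\<index>\<close> 70)

definition hom :: "('o, 'm, 'x) category_data_scheme \<Rightarrow> 'o \<Rightarrow> 'o \<Rightarrow> 'm set" where
  "hom X A B = {f \<in> Ar X. Dom X f = A \<and> Cod X f = B}"

locale category =
  fixes X :: "('o, 'm, 'x) category_data_scheme" (structure)
  assumes Dom_Ob: "f \<in> Ar X \<Longrightarrow> Dom X f \<in> Ob X"
    and Cod_Ob: "f \<in> Ar X \<Longrightarrow> Cod X f \<in> Ob X"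
    and Id_hom: "A \<in> Ob X \<Longrightarrow> Id X A \<in> hom X A A"
    and Comp_hom: "f \<in> hom X A B \<Longrightarrow> g \<in> hom X B D \<Longrightarrow> f \<cdot> g \<in> hom X A D"
    and Id_left: "f \<in> hom X A B \<Longrightarrow> Id X A \<cdot> f = f"
    and Id_right: "f \<in> hom X A B \<Longrightarrow> f \<cdot> Id X B = f"
    and Comp_assoc: "f \<in> hom X A B \<Longrightarrow> g \<in> hom X B D \<Longrightarrow> h \<in> hom X D E
      \<Longrightarrow> f \<cdot> g \<cdot> h = f \<cdot> (g \<cdot> h)"

definition is_inverse :: "('o, 'm, 'x) category_data_scheme \<Rightarrow> 'm \<Rightarrow> 'm \<Rightarrow> bool" where
  "is_inverse X f g \<longleftrightarrow> g \<in> hom X (Cod X f) (Dom X f)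
     \<and> Comp X f g = Id X (Dom X f) \<and> Comp X g f = Id X (Cod X f)"

definition is_iso :: "('o, 'm, 'x) category_data_scheme \<Rightarrow> 'm \<Rightarrow> bool" where
  "is_iso X f \<longleftrightarrow> f \<in> Ar X \<and> (\<exists>g. is_inverse X f g)"

definition inverse_arrow :: "('o, 'm, 'x) category_data_scheme \<Rightarrow> 'm \<Rightarrow> 'm" where
  "inverse_arrow X f = (THE g. is_inverse X f g)"

definition is_endofunctor ::
  "('o, 'm, 'x) category_data_scheme \<Rightarrow> ('o \<Rightarrow> 'o) \<Rightarrow> ('m \<Rightarrow> 'm) \<Rightarrow> bool" where
  "is_endofunctor X FO FA \<longleftrightarrow>
     (\<forall>A\<in>Ob X. FO A \<in> Ob X \<and> FA (Id X A) = Id X (FO A))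
   \<and> (\<forall>f\<in>Ar X. FA f \<in> hom X (FO (Dom X f)) (FO (Cod X f)))
   \<and> (\<forall>f\<in>Ar X. \<forall>g\<in>Ar X. Cod X f = Dom X g \<longrightarrow> FA (Comp X f g) = Comp X (FA f) (FA g))"

definition is_natural ::
  "('o, 'm, 'x) category_data_scheme \<Rightarrow> ('o \<Rightarrow> 'o) \<Rightarrow> ('m \<Rightarrow> 'm) \<Rightarrow> ('o \<Rightarrow> 'o) \<Rightarrow> ('m \<Rightarrow> 'm)
     \<Rightarrow> ('o \<Rightarrow> 'm) \<Rightarrow> bool" where
  "is_natural X FO FA GO GA \<eta> \<longleftrightarrow>
     (\<forall>A\<in>Ob X. \<eta> A \<in> hom X (FO A) (GO A))
   \<and> (\<forall>f\<in>Ar X. Comp X (FA f) (\<eta> (Cod X f)) = Comp X (\<eta> (Dom X f)) (GA f))"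

section \<open>Limits\<close>

definition is_equalizer :: "('o, 'm, 'x) category_data_scheme \<Rightarrow> 'm \<Rightarrow> 'm \<Rightarrow> 'm \<Rightarrow> bool" where
  "is_equalizer X e f g \<longleftrightarrow>
     f \<in> Ar X \<and> g \<in> hom X (Dom X f) (Cod X f) \<and> e \<in> Ar X \<and> Cod X e = Dom X f
   \<and> Comp X e f = Comp X e g
   \<and> (\<forall>Q\<in>Ob X. \<forall>h\<in>hom X Q (Dom X f). Comp X h f = Comp X h g
        \<longrightarrow> (\<exists>!l. l \<in> hom X Q (Dom X e) \<and> Comp X l e = h))"

text \<open>\<open>P\<close> with projections \<open>a\<close>, \<open>b\<close> is a pullback of \<open>f\<close> and \<open>g\<close>, where \<open>a \<cdot> f = b \<cdot> g\<close>.\<close>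

definition is_pullback ::
  "('o, 'm, 'x) category_data_scheme \<Rightarrow> 'o \<Rightarrow> 'm \<Rightarrow> 'm \<Rightarrow> 'm \<Rightarrow> 'm \<Rightarrow> bool" where
  "is_pullback X P a b f g \<longleftrightarrow>
     f \<in> Ar X \<and> g \<in> Ar X \<and> Cod X f = Cod X g
   \<and> a \<in> hom X P (Dom X f) \<and> b \<in> hom X P (Dom X g) \<and> Comp X a f = Comp X b g
   \<and> (\<forall>Q\<in>Ob X. \<forall>h\<in>hom X Q (Dom X f). \<forall>k\<in>hom X Q (Dom X g). Comp X h f = Comp X k g
        \<longrightarrow> (\<exists>!l. l \<in> hom X Q P \<and> Comp X l a = h \<and> Comp X l b = k))"

text \<open>\<open>P\<close> with projections \<open>\<pi> i\<close>, \<open>i < n\<close>, is the \<open>n\<close>-fold fibre product of \<open>q\<close> over its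
  codomain. This is used for \<open>n \<ge> 1\<close> only: with no projections there is no map to the
  codomain, and the \<open>0\<close>-fold fibre product is the codomain itself anyway.\<close>

definition is_fibre_power ::
  "('o, 'm, 'x) category_data_scheme \<Rightarrow> 'm \<Rightarrow> nat \<Rightarrow> 'o \<Rightarrow> (nat \<Rightarrow> 'm) \<Rightarrow> bool" where
  "is_fibre_power X q n P \<pi> \<longleftrightarrow>
     q \<in> Ar X
   \<and> (\<forall>i<n. \<pi> i \<in> hom X P (Dom X q))
   \<and> (\<forall>i<n. \<forall>j<n. Comp X (\<pi> i) q = Comp X (\<pi> j) q)
   \<and> (\<forall>Q\<in>Ob X. \<forall>h. (\<forall>i<n. h i \<in> hom X Q (Dom X q))
          \<and> (\<forall>i<n. \<forall>j<n. Comp X (h i) q = Comp X (h j) q)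
        \<longrightarrow> (\<exists>!l. l \<in> hom X Q P \<and> (\<forall>i<n. Comp X l (\<pi> i) = h i)))"

definition is_terminal :: "('o, 'm, 'x) category_data_scheme \<Rightarrow> 'o \<Rightarrow> bool" where
  "is_terminal X U \<longleftrightarrow> U \<in> Ob X \<and> (\<forall>A\<in>Ob X. \<exists>!f. f \<in> hom X A U)"

definition is_product ::
  "('o, 'm, 'x) category_data_scheme \<Rightarrow> 'o \<Rightarrow> 'm \<Rightarrow> 'm \<Rightarrow> 'o \<Rightarrow> 'o \<Rightarrow> bool" where
  "is_product X P a b A B \<longleftrightarrow>
     A \<in> Ob X \<and> B \<in> Ob X \<and> a \<in> hom X P A \<and> b \<in> hom X P B
   \<and> (\<forall>Q\<in>Ob X. \<forall>f\<in>hom X Q A. \<forall>g\<in>hom X Q B.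
        \<exists>!l. l \<in> hom X Q P \<and> Comp X l a = f \<and> Comp X l b = g)"

text \<open>The pairing of \<open>f\<close> and \<open>g\<close> into a binary product or fibre product \<open>P\<close> with projections
  \<open>a\<close>, \<open>b\<close>.\<close>

definition pairing ::
  "('o, 'm, 'x) category_data_scheme \<Rightarrow> 'o \<Rightarrow> 'm \<Rightarrow> 'm \<Rightarrow> 'm \<Rightarrow> 'm \<Rightarrow> 'm" where
  "pairing X P a b f g = (THE l. l \<in> hom X (Dom X f) P \<and> Comp X l a = f \<and> Comp X l b = g)"

section \<open>Additive bundles\<close>

text \<open>A commutative monoid \<open>q\<close> over its codomain, with addition \<open>add\<close> and zero \<open>z\<close>; the
  \<open>n\<close>-fold fibre product of \<open>q\<close> is \<open>P n\<close>, with projections \<open>\<pi> n i\<close> for \<open>i < n\<close>.\<close>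

definition additive_bundle ::
  "('o, 'm, 'x) category_data_scheme \<Rightarrow> 'm \<Rightarrow> (nat \<Rightarrow> 'o) \<Rightarrow> (nat \<Rightarrow> nat \<Rightarrow> 'm) \<Rightarrow> 'm \<Rightarrow> 'm
     \<Rightarrow> bool" where
  "additive_bundle X q P \<pi> add z \<longleftrightarrow>
    (let pair = pairing X (P 2) (\<pi> 2 0) (\<pi> 2 1) in
       q \<in> Ar X
     \<and> (\<forall>n\<ge>1. is_fibre_power X q n (P n) (\<pi> n))
     \<and> add \<in> hom X (P 2) (Dom X q)
     \<and> Comp X add q = Comp X (\<pi> 2 0) q
     \<and> Comp X add q = Comp X (\<pi> 2 1) q
     \<and> z \<in> hom X (Cod X q) (Dom X q)
     \<and> Comp X z q = Id X (Cod X q)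
     \<and> Comp X (pair (Comp X (pair (\<pi> 3 0) (\<pi> 3 1)) add) (\<pi> 3 2)) add
         = Comp X (pair (\<pi> 3 0) (Comp X (pair (\<pi> 3 1) (\<pi> 3 2)) add)) add
     \<and> Comp X (pair (\<pi> 2 1) (\<pi> 2 0)) add = add
     \<and> Comp X (pair (Id X (Dom X q)) (Comp X q z)) add = Id X (Dom X q)
     \<and> Comp X (pair (Comp X q z) (Id X (Dom X q))) add = Id X (Dom X q))"

text \<open>\<open>(f, g)\<close> is a morphism from the bundle \<open>(q, add, z)\<close>, with binary fibre product \<open>P\<close> and
  projections \<open>a\<close>, \<open>b\<close>, to the bundle \<open>(q', add', z')\<close>, with binary fibre product \<open>P'\<close> and
  projections \<open>a'\<close>, \<open>b'\<close>.\<close>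

definition additive_bundle_morphism ::
  "('o, 'm, 'x) category_data_scheme \<Rightarrow> 'm \<Rightarrow> 'm
     \<Rightarrow> 'm \<Rightarrow> 'o \<Rightarrow> 'm \<Rightarrow> 'm \<Rightarrow> 'm \<Rightarrow> 'm
     \<Rightarrow> 'm \<Rightarrow> 'o \<Rightarrow> 'm \<Rightarrow> 'm \<Rightarrow> 'm \<Rightarrow> 'm \<Rightarrow> bool" where
  "additive_bundle_morphism X f g q P a b add z q' P' a' b' add' z' \<longleftrightarrow>
     f \<in> hom X (Dom X q) (Dom X q') \<and> g \<in> hom X (Cod X q) (Cod X q')
   \<and> Comp X f q' = Comp X q g
   \<and> Comp X add f = Comp X (pairing X P' a' b' (Comp X a f) (Comp X b f)) add'
   \<and> Comp X z f = Comp X g z'"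

section \<open>Tangent categories\<close>

text \<open>\<open>T\<^sub>n(M)\<close> is \<open>Tpow X n M\<close> with projections \<open>Tprj X n i M\<close> to \<open>T(M)\<close> for \<open>i < n\<close>.\<close>

record ('o, 'm) tangent_data = "('o, 'm) category_data" +
  Tobj :: "'o \<Rightarrow> 'o"  (\<open>TO\<index>\<close>)
  Tarr :: "'m \<Rightarrow> 'm"  (\<open>TA\<index>\<close>)
  Tproj :: "'o \<Rightarrow> 'm"  (\<open>\<p>\<index>\<close>)
  Tpow :: "nat \<Rightarrow> 'o \<Rightarrow> 'o"
  Tprj :: "nat \<Rightarrow> nat \<Rightarrow> 'o \<Rightarrow> 'm"
  Tzero :: "'o \<Rightarrow> 'm"  (\<open>\<zero>\<index>\<close>)
  Tplus :: "'o \<Rightarrow> 'm"  (\<open>\<oplus>\<index>\<close>)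
  Tlift :: "'o \<Rightarrow> 'm"  (\<open>\<l>\<index>\<close>)
  Tflip :: "'o \<Rightarrow> 'm"  (\<open>\<c>\<index>\<close>)

abbreviation T2O :: "('o, 'm, 'x) tangent_data_scheme \<Rightarrow> 'o \<Rightarrow> 'o" where
  "T2O X M \<equiv> Tpow X 2 M"

definition T2A :: "('o, 'm, 'x) tangent_data_scheme \<Rightarrow> 'm \<Rightarrow> 'm" where
  "T2A X f = pairing X (T2O X (Cod X f)) (Tprj X 2 0 (Cod X f)) (Tprj X 2 1 (Cod X f))
     (Comp X (Tprj X 2 0 (Dom X f)) (Tarr X f)) (Comp X (Tprj X 2 1 (Dom X f)) (Tarr X f))"

text \<open>The pairing into \<open>T(T\<^sub>2(M))\<close>, as the fibre product of \<open>T(p)\<close> with itself.\<close>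

definition T_pairing :: "('o, 'm, 'x) tangent_data_scheme \<Rightarrow> 'o \<Rightarrow> 'm \<Rightarrow> 'm \<Rightarrow> 'm" where
  "T_pairing X M = pairing X (Tobj X (T2O X M)) (Tarr X (Tprj X 2 0 M)) (Tarr X (Tprj X 2 1 M))"

locale tangent_category = category X
  for X :: "('o, 'm, 'x) tangent_data_scheme" (structure) +
  assumes T_functor: "is_endofunctor X TO TA"
    and p_natural: "is_natural X TO TA id id \<p>"
    and pow_pullback: "M \<in> Ob X \<Longrightarrow> n \<ge> 1
      \<Longrightarrow> is_fibre_power X (\<p> M) n (Tpow X n M) (\<lambda>i. Tprj X n i M)"
    and pow_preserved: "M \<in> Ob X \<Longrightarrow> n \<ge> 1
      \<Longrightarrow> is_fibre_power X (TA (\<p> M)) n (TO (Tpow X n M)) (\<lambda>i. TA (Tprj X n i M))"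
    and plus_natural: "is_natural X (T2O X) (T2A X) TO TA \<oplus>"
    and zero_natural: "is_natural X id id TO TA \<zero>"
    and p_additive: "M \<in> Ob X
      \<Longrightarrow> additive_bundle X (\<p> M) (\<lambda>n. Tpow X n M) (\<lambda>n i. Tprj X n i M) (\<oplus> M) (\<zero> M)"
    and lift_natural: "is_natural X TO TA (TO \<circ> TO) (TA \<circ> TA) \<l>"
    and lift_additive: "M \<in> Ob X \<Longrightarrow> additive_bundle_morphism X (\<l> M) (\<zero> M)
          (\<p> M) (T2O X M) (Tprj X 2 0 M) (Tprj X 2 1 M) (\<oplus> M) (\<zero> M)
          (TA (\<p> M)) (TO (T2O X M)) (TA (Tprj X 2 0 M)) (TA (Tprj X 2 1 M))
            (TA (\<oplus> M)) (TA (\<zero> M))"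
    and flip_natural: "is_natural X (TO \<circ> TO) (TA \<circ> TA) (TO \<circ> TO) (TA \<circ> TA) \<c>"
    and flip_flip: "M \<in> Ob X \<Longrightarrow> \<c> M \<cdot> \<c> M = Id X (TO (TO M))"
    and lift_flip: "M \<in> Ob X \<Longrightarrow> \<l> M \<cdot> \<c> M = \<l> M"
    and flip_additive: "M \<in> Ob X \<Longrightarrow> additive_bundle_morphism X (\<c> M) (Id X (TO M))
          (TA (\<p> M)) (TO (T2O X M)) (TA (Tprj X 2 0 M)) (TA (Tprj X 2 1 M))
            (TA (\<oplus> M)) (TA (\<zero> M))
          (\<p> (TO M)) (T2O X (TO M)) (Tprj X 2 0 (TO M)) (Tprj X 2 1 (TO M))
            (\<oplus> (TO M)) (\<zero> (TO M))"
    and lift_lift: "M \<in> Ob X \<Longrightarrow> \<l> M \<cdot> TA (\<l> M) = \<l> M \<cdot> \<l> (TO M)"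
    and flip_braid: "M \<in> Ob X
      \<Longrightarrow> TA (\<c> M) \<cdot> \<c> (TO M) \<cdot> TA (\<c> M) = \<c> (TO M) \<cdot> TA (\<c> M) \<cdot> \<c> (TO M)"
    and lift_flip_flip: "M \<in> Ob X
      \<Longrightarrow> \<l> (TO M) \<cdot> TA (\<c> M) \<cdot> \<c> (TO M) = \<c> M \<cdot> TA (\<l> M)"
    and lift_universal: "M \<in> Ob X \<Longrightarrow> is_equalizer X
          (T_pairing X M (Tprj X 2 0 M \<cdot> \<l> M) (Tprj X 2 1 M \<cdot> \<zero> (TO M)) \<cdot> TA (\<oplus> M))
          (TA (\<p> M)) (TA (\<p> M) \<cdot> \<p> M \<cdot> \<zero> M)"

section \<open>Cartesian tangent categories\<close>

record ('o, 'm) cartesian_tangent_data = "('o, 'm) tangent_data" +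
  One :: "'o"
  Prd :: "'o \<Rightarrow> 'o \<Rightarrow> 'o"
  Fst :: "'o \<Rightarrow> 'o \<Rightarrow> 'm"
  Snd :: "'o \<Rightarrow> 'o \<Rightarrow> 'm"

definition bang :: "('o, 'm, 'x) cartesian_tangent_data_scheme \<Rightarrow> 'o \<Rightarrow> 'm" where
  "bang X A = (THE f. f \<in> hom X A (One X))"

definition prod_pair ::
  "('o, 'm, 'x) cartesian_tangent_data_scheme \<Rightarrow> 'm \<Rightarrow> 'm \<Rightarrow> 'm"  (\<open>\<langle>_,/ _\<rangle>\<index>\<close>) where
  "prod_pair X f g = pairing X (Prd X (Cod X f) (Cod X g))
     (Fst X (Cod X f) (Cod X g)) (Snd X (Cod X f) (Cod X g)) f g"

definition prod_map ::
  "('o, 'm, 'x) cartesian_tangent_data_scheme \<Rightarrow> 'm \<Rightarrow> 'm \<Rightarrow> 'm"  (infixl \<open>\<otimes>\<index>\<close> 75) where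
  "prod_map X f g = prod_pair X (Comp X (Fst X (Dom X f) (Dom X g)) f)
     (Comp X (Snd X (Dom X f) (Dom X g)) g)"

text \<open>The canonical comparison \<open>T(A \<times> B) \<rightarrow> T(A) \<times> T(B)\<close>, and its inverse.\<close>

definition T_split :: "('o, 'm, 'x) cartesian_tangent_data_scheme \<Rightarrow> 'o \<Rightarrow> 'o \<Rightarrow> 'm" where
  "T_split X A B = prod_pair X (Tarr X (Fst X A B)) (Tarr X (Snd X A B))"

definition T_merge :: "('o, 'm, 'x) cartesian_tangent_data_scheme \<Rightarrow> 'o \<Rightarrow> 'o \<Rightarrow> 'm"  (\<open>\<alpha>\<index>\<close>)
  where "T_merge X A B = inverse_arrow X (T_split X A B)"

text \<open>The map \<open>T\<^sub>2(A) \<times> T\<^sub>2(B) \<rightarrow> T\<^sub>2(A \<times> B)\<close> which is \<open>T_merge\<close> in both components.\<close>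

definition T2_merge :: "('o, 'm, 'x) cartesian_tangent_data_scheme \<Rightarrow> 'o \<Rightarrow> 'o \<Rightarrow> 'm" where
  "T2_merge X A B = pairing X (T2O X (Prd X A B))
     (Tprj X 2 0 (Prd X A B)) (Tprj X 2 1 (Prd X A B))
     (Comp X (prod_map X (Tprj X 2 0 A) (Tprj X 2 0 B)) (T_merge X A B))
     (Comp X (prod_map X (Tprj X 2 1 A) (Tprj X 2 1 B)) (T_merge X A B))"

text \<open>For the terminal object only invertibility of the comparison \<open>T(1) \<rightarrow> 1\<close> has to be
  required: it makes every \<open>T\<^sup>k(1)\<close> terminal, so compatibility with the structure maps is
  automatic, and the inverse is \<open>0\<^sub>1\<close>.\<close>

locale cartesian_tangent_category = tangent_category X
  for X :: "('o, 'm, 'x) cartesian_tangent_data_scheme" (structure) +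
  assumes One_terminal: "is_terminal X (One X)"
    and Prd_product: "A \<in> Ob X \<Longrightarrow> B \<in> Ob X
      \<Longrightarrow> is_product X (Prd X A B) (Fst X A B) (Snd X A B) A B"
    and T_One_iso: "is_iso X (bang X (TO (One X)))"
    and T_Prd_iso: "A \<in> Ob X \<Longrightarrow> B \<in> Ob X \<Longrightarrow> is_iso X (T_split X A B)"
    and merge_p: "A \<in> Ob X \<Longrightarrow> B \<in> Ob X \<Longrightarrow> \<alpha> A B \<cdot> \<p> (Prd X A B) = \<p> A \<otimes> \<p> B"
    and merge_zero: "A \<in> Ob X \<Longrightarrow> B \<in> Ob X \<Longrightarrow> (\<zero> A \<otimes> \<zero> B) \<cdot> \<alpha> A B = \<zero> (Prd X A B)"
    and merge_plus: "A \<in> Ob X \<Longrightarrow> B \<in> Ob X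
      \<Longrightarrow> (\<oplus> A \<otimes> \<oplus> B) \<cdot> \<alpha> A B = T2_merge X A B \<cdot> \<oplus> (Prd X A B)"
    and merge_lift: "A \<in> Ob X \<Longrightarrow> B \<in> Ob X
      \<Longrightarrow> (\<l> A \<otimes> \<l> B) \<cdot> (\<alpha> (TO A) (TO B) \<cdot> TA (\<alpha> A B)) = \<alpha> A B \<cdot> \<l> (Prd X A B)"
    and merge_flip: "A \<in> Ob X \<Longrightarrow> B \<in> Ob X
      \<Longrightarrow> (\<c> A \<otimes> \<c> B) \<cdot> (\<alpha> (TO A) (TO B) \<cdot> TA (\<alpha> A B))
        = \<alpha> (TO A) (TO B) \<cdot> TA (\<alpha> A B) \<cdot> \<c> (Prd X A B)"

section \<open>Group objects and left-invariant vector fields\<close>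

locale group_object =
  fixes X :: "('o, 'm, 'x) cartesian_tangent_data_scheme" (structure)
    and G :: 'o and m u \<iota> :: 'm
  assumes G_Ob: "G \<in> Ob X"
    and m_hom: "m \<in> hom X (Prd X G G) G"
    and u_hom: "u \<in> hom X (One X) G"
    and inv_hom: "\<iota> \<in> hom X G G"
    and m_assoc: "(m \<otimes> Id X G) \<cdot> m
      = \<langle>Fst X (Prd X G G) G \<cdot> Fst X G G, \<langle>Fst X (Prd X G G) G \<cdot> Snd X G G, Snd X (Prd X G G) G\<rangle>\<rangle>
          \<cdot> (Id X G \<otimes> m) \<cdot> m"
    and unit_left: "\<langle>bang X G \<cdot> u, Id X G\<rangle> \<cdot> m = Id X G"
    and unit_right: "\<langle>Id X G, bang X G \<cdot> u\<rangle> \<cdot> m = Id X G"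
    and inv_left: "\<langle>\<iota>, Id X G\<rangle> \<cdot> m = bang X G \<cdot> u"
    and inv_right: "\<langle>Id X G, \<iota>\<rangle> \<cdot> m = bang X G \<cdot> u"

definition left_invariant_vector_field ::
  "('o, 'm, 'x) cartesian_tangent_data_scheme \<Rightarrow> 'o \<Rightarrow> 'm \<Rightarrow> 'm \<Rightarrow> bool" where
  "left_invariant_vector_field X G m \<xi> \<longleftrightarrow>
     \<xi> \<in> hom X G (Tobj X G)
   \<and> Comp X \<xi> (Tproj X G) = Id X G
   \<and> Comp X (Comp X (prod_map X (Tzero X G) \<xi>) (T_merge X G G)) (Tarr X m) = Comp X m \<xi>"

definition elements :: "('o, 'm, 'x) cartesian_tangent_data_scheme \<Rightarrow> 'o \<Rightarrow> 'm set" where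
  "elements X A = hom X (One X) A"

end

theory Submission
  imports Defs
begin

text \<open>
  A left-invariant vector field is determined by its value at the unit, and every tangent
  vector at the unit can be translated around the group.

  Since \<open>T\<close> preserves products, maps \<open>f, g : Q \<rightarrow> T(G)\<close> can be paired to a map
  \<open>Q \<rightarrow> T(G \<times> G)\<close> and multiplied by \<open>T(m)\<close>. This product, written \<open>f \<star> g\<close>, is
  associative (\<open>tangent_mult_assoc\<close>, by applying \<open>T\<close> to the associativity of \<open>m\<close>), the zero
  vectors satisfy \<open>x 0 \<star> y 0 = \<langle>x, y\<rangle> m 0\<close> (\<open>tangent_mult_zero\<close>, by naturality of \<open>0\<close>), and
  the zero vector at the unit is a left unit (\<open>tangent_mult_unit_left\<close>). In these terms
  left-invariance of \<open>\<xi>\<close> says \<open>x 0 \<star> y \<xi> = \<langle>x, y\<rangle> m \<xi>\<close> for generalized elements \<open>x\<close>, \<open>y\<close>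
  of \<open>G\<close>, and the translate of a tangent vector \<open>v : 1 \<rightarrow> T(G)\<close> is the vector field
  \<open>\<xi>\<^sub>v = 0 \<star> ! v\<close>.

  The field \<open>\<xi>\<^sub>v\<close> is left-invariant by associativity:
  \<open>m \<xi>\<^sub>v = (\<pi>\<^sub>0 0 \<star> \<pi>\<^sub>1 0) \<star> ! v = \<pi>\<^sub>0 0 \<star> (\<pi>\<^sub>1 0 \<star> ! v) = \<pi>\<^sub>0 0 \<star> \<pi>\<^sub>1 \<xi>\<^sub>v\<close>.
  If \<open>v\<close> lies over \<open>u\<close>, then \<open>\<xi>\<^sub>v\<close> is a section of \<open>p\<close>, and \<open>u \<xi>\<^sub>v = u 0 \<star> v = v\<close>.
  Conversely, putting \<open>x = 1\<close> and \<open>y = ! u\<close> in the invariance of \<open>\<xi>\<close> gives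
  \<open>0 \<star> ! u \<xi> = \<xi>\<close>. So evaluation at \<open>u\<close> is a bijection onto the maps \<open>v : 1 \<rightarrow> T(G)\<close> with
  \<open>v p = u\<close>, and these are the elements of the pullback of \<open>p\<close> along \<open>u\<close>.
\<close>

section \<open>Categories\<close>

lemma homD:
  assumes "f \<in> hom X A B"
  shows "f \<in> Ar X" "Dom X f = A" "Cod X f = B"
  using assms by (auto simp: hom_def)

context category
begin

text \<open>Typing in terms of \<open>Dom\<close> and \<open>Cod\<close> rather than \<open>hom\<close>: the intermediate objects of a
  composite need not be guessed, so that the simplifier can decide composability.\<close>

lemma Comp_arrow [simp]:
  assumes "f \<in> Ar X" "g \<in> Ar X" "Cod X f = Dom X g"
  shows "f \<cdot> g \<in> Ar X" "Dom X (f \<cdot> g) = Dom X f" "Cod X (f \<cdot> g) = Cod X g"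
  using Comp_hom[of f "Dom X f" "Dom X g" g "Cod X g"] assms by (auto simp: hom_def)

lemma Id_arrow [simp]:
  assumes "A \<in> Ob X"
  shows "Id X A \<in> Ar X" "Dom X (Id X A) = A" "Cod X (Id X A) = A"
  using Id_hom[OF assms] by (auto simp: hom_def)

lemma Comp_assoc_arrow:
  assumes "f \<in> Ar X" "g \<in> Ar X" "h \<in> Ar X" "Cod X f = Dom X g" "Cod X g = Dom X h"
  shows "f \<cdot> g \<cdot> h = f \<cdot> (g \<cdot> h)"
  using Comp_assoc[of f "Dom X f" "Dom X g" g "Dom X h" h "Cod X h"] assms
  by (auto simp: hom_def)

lemma Id_left_arrow [simp]: "f \<in> Ar X \<Longrightarrow> Dom X f = A \<Longrightarrow> Id X A \<cdot> f = f"
  using Id_left[of f A "Cod X f"] by (auto simp: hom_def)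

lemma Id_right_arrow [simp]: "f \<in> Ar X \<Longrightarrow> Cod X f = A \<Longrightarrow> f \<cdot> Id X A = f"
  using Id_right[of f "Dom X f" A] by (auto simp: hom_def)

lemma pairing_product:
  assumes "is_product X P a b A B" "f \<in> hom X Q A" "g \<in> hom X Q B"
  shows "pairing X P a b f g \<in> hom X Q P"
    "pairing X P a b f g \<cdot> a = f" "pairing X P a b f g \<cdot> b = g"
proof -
  have "Q \<in> Ob X" using assms(2) Dom_Ob by (auto simp: hom_def)
  then have "\<exists>!l. l \<in> hom X (Dom X f) P \<and> l \<cdot> a = f \<and> l \<cdot> b = g"
    using assms by (auto simp: is_product_def homD)
  from theI'[OF this]
  show "pairing X P a b f g \<in> hom X Q P"
    "pairing X P a b f g \<cdot> a = f" "pairing X P a b f g \<cdot> b = g"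
    using homD(2)[OF assms(2)] by (simp_all add: pairing_def)
qed

lemma product_eqI:
  assumes "is_product X P a b A B" "k \<in> hom X Q P" "l \<in> hom X Q P"
    "k \<cdot> a = l \<cdot> a" "k \<cdot> b = l \<cdot> b"
  shows "k = l"
proof -
  have "Q \<in> Ob X" using assms(2) Dom_Ob by (auto simp: hom_def)
  moreover have "l \<cdot> a \<in> hom X Q A" "l \<cdot> b \<in> hom X Q B"
    using assms(1,3) Comp_hom unfolding is_product_def by blast+
  ultimately show ?thesis
    using assms unfolding is_product_def by metis
qed

text \<open>Since \<open>U\<close> is terminal, an element of the pullback carries no information besides its
  projection to the domain of \<open>f\<close>.\<close>

lemma bij_betw_pullback_elements:
  assumes U: "is_terminal X U" and g: "g \<in> hom X U B" and P: "is_pullback X P a b f g"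
  shows "bij_betw (\<lambda>V. V \<cdot> a) (hom X U P) {h \<in> hom X U (Dom X f). h \<cdot> f = g}"
proof -
  have UO: "U \<in> Ob X" and f: "f \<in> Ar X" and b: "b \<in> hom X P U" and a: "a \<in> hom X P (Dom X f)"
    and comm: "a \<cdot> f = b \<cdot> g"
    and univ: "\<And>h k. h \<in> hom X U (Dom X f) \<Longrightarrow> k \<in> hom X U U \<Longrightarrow> h \<cdot> f = k \<cdot> g
      \<Longrightarrow> \<exists>!l. l \<in> hom X U P \<and> l \<cdot> a = h \<and> l \<cdot> b = k"
    using U P homD[OF g] by (auto simp: is_terminal_def is_pullback_def)
  have endo: "k = Id X U" if "k \<in> hom X U U" for k
    using U UO that Id_hom unfolding is_terminal_def by blast
  have V_b: "V \<cdot> b = Id X U" if "V \<in> hom X U P" for V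
    using endo Comp_hom[OF that b] by blast
  have ex1: "\<exists>!V. V \<in> hom X U P \<and> V \<cdot> a = h" if "h \<in> hom X U (Dom X f)" "h \<cdot> f = g" for h
    using univ[OF that(1) Id_hom[OF UO]] that(2) V_b Id_left[OF g] by metis
  have over: "V \<cdot> a \<in> hom X U (Dom X f)" "V \<cdot> a \<cdot> f = g" if V: "V \<in> hom X U P" for V
  proof -
    show "V \<cdot> a \<in> hom X U (Dom X f)" using Comp_hom[OF V a] .
    have "V \<cdot> a \<cdot> f = V \<cdot> b \<cdot> g"
      using homD[OF V] homD[OF a] homD[OF b] homD[OF g] f comm
      by (simp add: Comp_assoc_arrow)
    then show "V \<cdot> a \<cdot> f = g" using V_b[OF V] Id_left[OF g] by simp
  qed
  show ?thesis
  proof (rule bij_betw_imageI)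
    show "inj_on (\<lambda>V. V \<cdot> a) (hom X U P)"
      using ex1 over by (intro inj_onI) metis
    show "(\<lambda>V. V \<cdot> a) ` hom X U P = {h \<in> hom X U (Dom X f). h \<cdot> f = g}"
      using ex1 over by (auto simp: image_iff) metis
  qed
qed

end

section \<open>Products in a Cartesian tangent category\<close>

context tangent_category
begin

lemma T_arrow [simp]:
  assumes "f \<in> Ar X"
  shows "TA f \<in> Ar X" "Dom X (TA f) = TO (Dom X f)" "Cod X (TA f) = TO (Cod X f)"
  using T_functor assms by (auto simp: is_endofunctor_def hom_def)

lemma T_Ob [simp]: "A \<in> Ob X \<Longrightarrow> TO A \<in> Ob X"
  and T_Id: "A \<in> Ob X \<Longrightarrow> TA (Id X A) = Id X (TO A)"
  using T_functor by (auto simp: is_endofunctor_def)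

lemma T_Comp: "f \<in> Ar X \<Longrightarrow> g \<in> Ar X \<Longrightarrow> Cod X f = Dom X g \<Longrightarrow> TA (f \<cdot> g) = TA f \<cdot> TA g"
  using T_functor by (auto simp: is_endofunctor_def)

lemma p_arrow [simp]:
  assumes "A \<in> Ob X"
  shows "\<p> A \<in> Ar X" "Dom X (\<p> A) = TO A" "Cod X (\<p> A) = A"
  using p_natural assms by (auto simp: is_natural_def hom_def)

lemma zero_arrow [simp]:
  assumes "A \<in> Ob X"
  shows "\<zero> A \<in> Ar X" "Dom X (\<zero> A) = A" "Cod X (\<zero> A) = TO A"
  using zero_natural assms by (auto simp: is_natural_def hom_def)

lemma p_naturality: "f \<in> Ar X \<Longrightarrow> TA f \<cdot> \<p> (Cod X f) = \<p> (Dom X f) \<cdot> f"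
  using p_natural by (auto simp: is_natural_def)

lemma zero_naturality: "f \<in> Ar X \<Longrightarrow> f \<cdot> \<zero> (Cod X f) = \<zero> (Dom X f) \<cdot> TA f"
  using zero_natural by (auto simp: is_natural_def)

lemma zero_p: "A \<in> Ob X \<Longrightarrow> \<zero> A \<cdot> \<p> A = Id X A"
  using p_additive[of A] by (auto simp: additive_bundle_def Let_def)

end

context cartesian_tangent_category
begin

lemma One_Ob [simp]: "One X \<in> Ob X"
  using One_terminal by (simp add: is_terminal_def)

lemma bang_hom: "A \<in> Ob X \<Longrightarrow> bang X A \<in> hom X A (One X)"
  using One_terminal theI'[of "\<lambda>f. f \<in> hom X A (One X)"]
  by (auto simp: is_terminal_def bang_def)

lemma bang_arrow [simp]:
  assumes "A \<in> Ob X"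
  shows "bang X A \<in> Ar X" "Dom X (bang X A) = A" "Cod X (bang X A) = One X"
  using homD[OF bang_hom[OF assms]] .

lemma into_One_eq:
  assumes "f \<in> hom X A (One X)" "g \<in> hom X A (One X)"
  shows "f = g"
proof -
  have "A \<in> Ob X" using assms(1) Dom_Ob by (auto simp: hom_def)
  then show ?thesis using One_terminal assms by (auto simp: is_terminal_def)
qed

lemma Comp_bang:
  assumes "f \<in> Ar X" "Cod X f = A"
  shows "f \<cdot> bang X A = bang X (Dom X f)"
proof (rule into_One_eq[of _ "Dom X f"])
  have "Dom X f \<in> Ob X" "A \<in> Ob X" using assms Dom_Ob Cod_Ob by auto
  then show "f \<cdot> bang X A \<in> hom X (Dom X f) (One X)" "bang X (Dom X f) \<in> hom X (Dom X f) (One X)"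
    using assms by (simp_all add: hom_def)
qed

lemma bang_One: "bang X (One X) = Id X (One X)"
  using into_One_eq[OF bang_hom[OF One_Ob] Id_hom[OF One_Ob]] .

text \<open>\<open>T(1)\<close> is again terminal, being isomorphic to \<open>1\<close>.\<close>

lemma into_T_One_eq:
  assumes "f \<in> hom X A (TO (One X))" "g \<in> hom X A (TO (One X))"
  shows "f = g"
proof -
  let ?b = "bang X (TO (One X))"
  obtain k where k: "k \<in> hom X (One X) (TO (One X))" "?b \<cdot> k = Id X (TO (One X))"
    using T_One_iso by (auto simp: is_iso_def is_inverse_def)
  have bk: "h \<cdot> ?b \<cdot> k = h" if "h \<in> hom X A (TO (One X))" for h
    using k homD[OF k(1)] homD[OF that] by (simp add: Comp_assoc_arrow)
  have "f \<cdot> ?b = g \<cdot> ?b"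
    using assms by (simp add: homD Comp_bang)
  then show ?thesis using bk[OF assms(1)] bk[OF assms(2)] by metis
qed

lemma Prd_projections [simp]:
  assumes "A \<in> Ob X" "B \<in> Ob X"
  shows "Fst X A B \<in> Ar X" "Dom X (Fst X A B) = Prd X A B" "Cod X (Fst X A B) = A"
    "Snd X A B \<in> Ar X" "Dom X (Snd X A B) = Prd X A B" "Cod X (Snd X A B) = B"
  using Prd_product[OF assms] by (auto simp: is_product_def hom_def)

lemma Prd_Ob [simp]: "A \<in> Ob X \<Longrightarrow> B \<in> Ob X \<Longrightarrow> Prd X A B \<in> Ob X"
  using Dom_Ob[of "Fst X A B"] by simp

lemma prod_pair_arrow [simp]:
  assumes "f \<in> Ar X" "g \<in> Ar X" "Dom X f = Dom X g"
  shows "\<langle>f, g\<rangle> \<in> Ar X" "Dom X \<langle>f, g\<rangle> = Dom X g" "Cod X \<langle>f, g\<rangle> = Prd X (Cod X f) (Cod X g)"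
  using homD[OF pairing_product(1)[OF Prd_product, of "Cod X f" "Cod X g" f "Dom X g" g]]
    assms Cod_Ob by (auto simp: prod_pair_def hom_def)

lemma prod_pair_projections [simp]:
  assumes "f \<in> Ar X" "g \<in> Ar X" "Dom X f = Dom X g" "Cod X f = A" "Cod X g = B"
  shows "\<langle>f, g\<rangle> \<cdot> Fst X A B = f" "\<langle>f, g\<rangle> \<cdot> Snd X A B = g"
  using pairing_product(2,3)[OF Prd_product, of "Cod X f" "Cod X g" f "Dom X g" g]
    assms Cod_Ob by (auto simp: prod_pair_def hom_def)

lemma Prd_eqI:
  assumes "k \<in> Ar X" "l \<in> Ar X" "Dom X k = Dom X l" "Cod X k = Prd X A B" "Cod X l = Prd X A B"
    "A \<in> Ob X" "B \<in> Ob X"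
    "k \<cdot> Fst X A B = l \<cdot> Fst X A B" "k \<cdot> Snd X A B = l \<cdot> Snd X A B"
  shows "k = l"
  using product_eqI[OF Prd_product, of A B k "Dom X k" l] assms by (auto simp: hom_def)

lemma Comp_prod_pair:
  assumes "x \<in> Ar X" "f \<in> Ar X" "g \<in> Ar X" "Dom X f = Dom X g" "Cod X x = Dom X g"
  shows "x \<cdot> \<langle>f, g\<rangle> = \<langle>x \<cdot> f, x \<cdot> g\<rangle>"
  by (rule Prd_eqI[where A = "Cod X f" and B = "Cod X g"])
    (use assms Cod_Ob in \<open>auto simp: Comp_assoc_arrow\<close>)

lemma Comp_Prd_eta:
  assumes "w \<in> Ar X" "A \<in> Ob X" "B \<in> Ob X" "Cod X w = Prd X A B"
  shows "\<langle>w \<cdot> Fst X A B, w \<cdot> Snd X A B\<rangle> = w"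
  by (rule Prd_eqI[where A = A and B = B]) (use assms in auto)

lemma prod_map_arrow [simp]:
  assumes "f \<in> Ar X" "g \<in> Ar X"
  shows "f \<otimes> g \<in> Ar X" "Dom X (f \<otimes> g) = Prd X (Dom X f) (Dom X g)"
    "Cod X (f \<otimes> g) = Prd X (Cod X f) (Cod X g)"
  using assms Dom_Ob by (auto simp: prod_map_def)

lemma Comp_prod_map:
  assumes "w \<in> Ar X" "f \<in> Ar X" "g \<in> Ar X" "Cod X w = Prd X (Dom X f) (Dom X g)"
  shows "w \<cdot> (f \<otimes> g)
    = \<langle>w \<cdot> Fst X (Dom X f) (Dom X g) \<cdot> f, w \<cdot> Snd X (Dom X f) (Dom X g) \<cdot> g\<rangle>"
  using assms Dom_Ob by (simp add: prod_map_def Comp_prod_pair Comp_assoc_arrow)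

text \<open>Because the comparison \<open>T(A \<times> B) \<rightarrow> T(A) \<times> T(B)\<close> is invertible, \<open>T(A \<times> B)\<close> is itself a
  product of \<open>T(A)\<close> and \<open>T(B)\<close>, with projections \<open>T(\<pi>\<^sub>0)\<close> and \<open>T(\<pi>\<^sub>1)\<close>. The pairing for
  this product is \<open>T_pair\<close>. Equations between maps into \<open>T(A \<times> B)\<close> can thus be checked on
  components, where \<open>p\<close> and \<open>0\<close> are governed by their naturality along the projections.\<close>

definition T_pair :: "'o \<Rightarrow> 'o \<Rightarrow> 'm \<Rightarrow> 'm \<Rightarrow> 'm" where
  "T_pair A B f g = \<langle>f, g\<rangle> \<cdot> \<alpha> A B"

lemma T_split_arrow:
  assumes "A \<in> Ob X" "B \<in> Ob X"
  shows "T_split X A B \<in> Ar X" "Dom X (T_split X A B) = TO (Prd X A B)"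
    "Cod X (T_split X A B) = Prd X (TO A) (TO B)"
    "T_split X A B \<cdot> Fst X (TO A) (TO B) = TA (Fst X A B)"
    "T_split X A B \<cdot> Snd X (TO A) (TO B) = TA (Snd X A B)"
  using assms by (simp_all add: T_split_def)

lemma inverse_arrow_is_inverse:
  assumes "is_iso X f"
  shows "is_inverse X f (inverse_arrow X f)"
proof -
  have f: "f \<in> Ar X" using assms by (simp add: is_iso_def)
  have "g = h" if g: "is_inverse X f g" and h: "is_inverse X f h" for g h
  proof -
    have "g = h \<cdot> f \<cdot> g"
      using g h by (auto simp: is_inverse_def homD)
    also have "\<dots> = h \<cdot> (f \<cdot> g)"
      using f g h by (intro Comp_assoc_arrow) (auto simp: is_inverse_def homD)
    also have "\<dots> = h"
      using g h by (auto simp: is_inverse_def homD)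
    finally show ?thesis .
  qed
  then have "\<exists>!g. is_inverse X f g" using assms by (auto simp: is_iso_def)
  from theI'[OF this] show ?thesis by (simp add: inverse_arrow_def)
qed

lemma T_merge_arrow:
  assumes "A \<in> Ob X" "B \<in> Ob X"
  shows "\<alpha> A B \<in> Ar X" "Dom X (\<alpha> A B) = Prd X (TO A) (TO B)"
    "Cod X (\<alpha> A B) = TO (Prd X A B)"
    "T_split X A B \<cdot> \<alpha> A B = Id X (TO (Prd X A B))"
    "\<alpha> A B \<cdot> T_split X A B = Id X (Prd X (TO A) (TO B))"
  using inverse_arrow_is_inverse[OF T_Prd_iso[OF assms]] T_split_arrow[OF assms]
  by (auto simp: is_inverse_def T_merge_def hom_def)

lemma T_merge_projections:
  assumes "A \<in> Ob X" "B \<in> Ob X"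
  shows "\<alpha> A B \<cdot> TA (Fst X A B) = Fst X (TO A) (TO B)"
    and "\<alpha> A B \<cdot> TA (Snd X A B) = Snd X (TO A) (TO B)"
proof -
  note facts = T_merge_arrow[OF assms] T_split_arrow[OF assms]
  have "\<alpha> A B \<cdot> T_split X A B \<cdot> Fst X (TO A) (TO B) = \<alpha> A B \<cdot> TA (Fst X A B)"
    using assms facts(1-3,6-9) by (subst Comp_assoc_arrow) auto
  then show "\<alpha> A B \<cdot> TA (Fst X A B) = Fst X (TO A) (TO B)" using assms facts(5) by simp
  have "\<alpha> A B \<cdot> T_split X A B \<cdot> Snd X (TO A) (TO B) = \<alpha> A B \<cdot> TA (Snd X A B)"
    using assms facts(1-3,6-8,10) by (subst Comp_assoc_arrow) auto
  then show "\<alpha> A B \<cdot> TA (Snd X A B) = Snd X (TO A) (TO B)" using assms facts(5) by simp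
qed

lemma T_pair_arrow [simp]:
  assumes "f \<in> Ar X" "g \<in> Ar X" "Dom X f = Dom X g" "Cod X f = TO A" "Cod X g = TO B"
    "A \<in> Ob X" "B \<in> Ob X"
  shows "T_pair A B f g \<in> Ar X" "Dom X (T_pair A B f g) = Dom X g"
    "Cod X (T_pair A B f g) = TO (Prd X A B)"
  using assms by (simp_all add: T_pair_def T_merge_arrow)

lemma T_pair_projections [simp]:
  assumes "f \<in> Ar X" "g \<in> Ar X" "Dom X f = Dom X g" "Cod X f = TO A" "Cod X g = TO B"
    "A \<in> Ob X" "B \<in> Ob X"
  shows "T_pair A B f g \<cdot> TA (Fst X A B) = f" "T_pair A B f g \<cdot> TA (Snd X A B) = g"
  using assms by (simp_all add: T_pair_def T_merge_arrow T_merge_projections Comp_assoc_arrow)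

lemma T_Prd_eqI:
  assumes k: "k \<in> Ar X" "Cod X k = TO (Prd X A B)" and l: "l \<in> Ar X" "Cod X l = TO (Prd X A B)"
    and D: "Dom X k = Dom X l" and AB: "A \<in> Ob X" "B \<in> Ob X"
    and Fst: "k \<cdot> TA (Fst X A B) = l \<cdot> TA (Fst X A B)"
    and Snd: "k \<cdot> TA (Snd X A B) = l \<cdot> TA (Snd X A B)"
  shows "k = l"
proof -
  note S = T_split_arrow[OF AB]
  have "k \<cdot> T_split X A B = l \<cdot> T_split X A B"
    by (rule Prd_eqI[where A = "TO A" and B = "TO B"])
      (use assms S in \<open>auto simp: Comp_assoc_arrow\<close>)
  then have "k \<cdot> T_split X A B \<cdot> \<alpha> A B = l \<cdot> T_split X A B \<cdot> \<alpha> A B" by simp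
  then show ?thesis
    using k l AB S(1-3) T_merge_arrow[OF AB] by (simp add: Comp_assoc_arrow)
qed

lemma Comp_T_pair:
  assumes "x \<in> Ar X" "f \<in> Ar X" "g \<in> Ar X" "Dom X f = Dom X g" "Cod X x = Dom X g"
    "Cod X f = TO A" "Cod X g = TO B" "A \<in> Ob X" "B \<in> Ob X"
  shows "x \<cdot> T_pair A B f g = T_pair A B (x \<cdot> f) (x \<cdot> g)"
  using assms by (simp add: T_pair_def T_merge_arrow Comp_prod_pair flip: Comp_assoc_arrow)

lemma Comp_T_prod_pair:
  assumes "w \<in> Ar X" "f \<in> Ar X" "g \<in> Ar X" "Dom X f = Dom X g" "Cod X w = TO (Dom X g)"
    "Cod X f = A" "Cod X g = B"
  shows "w \<cdot> TA \<langle>f, g\<rangle> = T_pair A B (w \<cdot> TA f) (w \<cdot> TA g)"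
proof -
  have AB: "A \<in> Ob X" "B \<in> Ob X" using assms Cod_Ob by auto
  show ?thesis
    by (rule T_Prd_eqI[where A = A and B = B])
      (use assms AB in \<open>auto simp: Comp_assoc_arrow simp flip: T_Comp\<close>)
qed

lemma T_pair_p:
  assumes "f \<in> Ar X" "g \<in> Ar X" "Dom X f = Dom X g" "Cod X f = TO A" "Cod X g = TO B"
    "A \<in> Ob X" "B \<in> Ob X"
  shows "T_pair A B f g \<cdot> \<p> (Prd X A B) = \<langle>f \<cdot> \<p> A, g \<cdot> \<p> B\<rangle>"
proof (rule Prd_eqI[where A = A and B = B])
  have nat: "T_pair A B f g \<cdot> \<p> (Prd X A B) \<cdot> h = T_pair A B f g \<cdot> TA h \<cdot> \<p> (Cod X h)"
    if "h \<in> Ar X" "Dom X h = Prd X A B" for h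
    using assms that p_naturality[OF that(1)] Cod_Ob by (simp add: Comp_assoc_arrow)
  show "T_pair A B f g \<cdot> \<p> (Prd X A B) \<cdot> Fst X A B = \<langle>f \<cdot> \<p> A, g \<cdot> \<p> B\<rangle> \<cdot> Fst X A B"
    using assms nat[of "Fst X A B"] by simp
  show "T_pair A B f g \<cdot> \<p> (Prd X A B) \<cdot> Snd X A B = \<langle>f \<cdot> \<p> A, g \<cdot> \<p> B\<rangle> \<cdot> Snd X A B"
    using assms nat[of "Snd X A B"] by simp
qed (use assms in auto)

lemma prod_pair_zero:
  assumes "f \<in> Ar X" "g \<in> Ar X" "Dom X f = Dom X g" "Cod X f = A" "Cod X g = B"
  shows "\<langle>f, g\<rangle> \<cdot> \<zero> (Prd X A B) = T_pair A B (f \<cdot> \<zero> A) (g \<cdot> \<zero> B)"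
proof (rule T_Prd_eqI[where A = A and B = B])
  have AB: "A \<in> Ob X" "B \<in> Ob X" using assms Cod_Ob by auto
  have nat: "\<langle>f, g\<rangle> \<cdot> \<zero> (Prd X A B) \<cdot> TA h = \<langle>f, g\<rangle> \<cdot> h \<cdot> \<zero> (Cod X h)"
    if "h \<in> Ar X" "Dom X h = Prd X A B" for h
    using assms AB that zero_naturality[OF that(1)] Cod_Ob by (simp add: Comp_assoc_arrow)
  show "\<langle>f, g\<rangle> \<cdot> \<zero> (Prd X A B) \<cdot> TA (Fst X A B)
      = T_pair A B (f \<cdot> \<zero> A) (g \<cdot> \<zero> B) \<cdot> TA (Fst X A B)"
    using assms AB nat[of "Fst X A B"] by simp
  show "\<langle>f, g\<rangle> \<cdot> \<zero> (Prd X A B) \<cdot> TA (Snd X A B)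
      = T_pair A B (f \<cdot> \<zero> A) (g \<cdot> \<zero> B) \<cdot> TA (Snd X A B)"
    using assms AB nat[of "Snd X A B"] by simp
qed (use assms Cod_Ob in auto)

end

section \<open>The multiplication on tangent vectors of a group object\<close>

locale tangent_group_object = cartesian_tangent_category X + group_object X G m u \<iota>
  for X :: "('o, 'm, 'x) cartesian_tangent_data_scheme" (structure)
    and G :: 'o and m u \<iota> :: 'm
begin

lemmas G_simps [simp] = G_Ob homD[OF m_hom] homD[OF u_hom]

definition tangent_mult :: "'m \<Rightarrow> 'm \<Rightarrow> 'm"  (infixl \<open>\<star>\<close> 73) where
  "f \<star> g = T_pair G G f g \<cdot> TA m"

lemma tangent_mult_arrow [simp]:
  assumes "f \<in> Ar X" "g \<in> Ar X" "Dom X f = Dom X g" "Cod X f = TO G" "Cod X g = TO G"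
  shows "f \<star> g \<in> Ar X" "Dom X (f \<star> g) = Dom X g" "Cod X (f \<star> g) = TO G"
  using assms by (simp_all add: tangent_mult_def)

lemma Comp_tangent_mult:
  assumes "x \<in> Ar X" "f \<in> Ar X" "g \<in> Ar X" "Dom X f = Dom X g" "Cod X x = Dom X g"
    "Cod X f = TO G" "Cod X g = TO G"
  shows "x \<cdot> (f \<star> g) = (x \<cdot> f) \<star> (x \<cdot> g)"
  using assms by (simp add: tangent_mult_def Comp_T_pair flip: Comp_assoc_arrow)

text \<open>Both sides arise from the triple \<open>(f, g, h)\<close>, seen as a map into \<open>T((G \<times> G) \<times> G)\<close>, by
  applying \<open>T\<close> to one of the two sides of the associativity of \<open>m\<close>.\<close>

lemma tangent_mult_assoc:
  assumes "f \<in> Ar X" "g \<in> Ar X" "h \<in> Ar X" "Dom X f = Dom X h" "Dom X g = Dom X h"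
    "Cod X f = TO G" "Cod X g = TO G" "Cod X h = TO G"
  shows "f \<star> g \<star> h = f \<star> (g \<star> h)"
proof -
  define w where "w = T_pair (Prd X G G) G (T_pair G G f g) h"
  let ?F = "Fst X (Prd X G G) G" and ?S = "Snd X (Prd X G G) G"
  let ?f = "?F \<cdot> Fst X G G" and ?g = "?F \<cdot> Snd X G G"
  have w [simp]: "w \<in> Ar X" "Dom X w = Dom X h" "Cod X w = TO (Prd X (Prd X G G) G)"
    using assms by (simp_all add: w_def)
  have wF: "w \<cdot> TA ?F = T_pair G G f g" and wS [simp]: "w \<cdot> TA ?S = h"
    using assms by (simp_all add: w_def)
  have wf [simp]: "w \<cdot> TA ?f = f" and wg [simp]: "w \<cdot> TA ?g = g"
    using assms wF by (simp_all add: T_Comp flip: Comp_assoc_arrow)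
  have mult: "w \<cdot> TA (\<langle>x, y\<rangle> \<cdot> m) = (w \<cdot> TA x) \<star> (w \<cdot> TA y)"
    if "x \<in> Ar X" "y \<in> Ar X" "Dom X x = Prd X (Prd X G G) G" "Dom X y = Prd X (Prd X G G) G"
      "Cod X x = G" "Cod X y = G" for x y
    using that by (simp add: T_Comp tangent_mult_def Comp_T_prod_pair flip: Comp_assoc_arrow)
  have F: "?F = \<langle>?f, ?g\<rangle>" by (simp add: Comp_Prd_eta)
  have "(m \<otimes> Id X G) = \<langle>?F \<cdot> m, ?S\<rangle>"
    by (simp add: prod_map_def)
  then have lhs: "(m \<otimes> Id X G) \<cdot> m = \<langle>\<langle>?f, ?g\<rangle> \<cdot> m, ?S\<rangle> \<cdot> m" using F by simp
  have rhs: "\<langle>?f, \<langle>?g, ?S\<rangle>\<rangle> \<cdot> (Id X G \<otimes> m) \<cdot> m = \<langle>?f, \<langle>?g, ?S\<rangle> \<cdot> m\<rangle> \<cdot> m"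
    by (simp add: Comp_prod_map)
  have eq: "\<langle>\<langle>?f, ?g\<rangle> \<cdot> m, ?S\<rangle> \<cdot> m = \<langle>?f, \<langle>?g, ?S\<rangle> \<cdot> m\<rangle> \<cdot> m"
    using m_assoc unfolding lhs rhs .
  have "f \<star> g \<star> h = w \<cdot> TA (\<langle>\<langle>?f, ?g\<rangle> \<cdot> m, ?S\<rangle> \<cdot> m)"
    by (simp add: mult)
  also have "\<dots> = w \<cdot> TA (\<langle>?f, \<langle>?g, ?S\<rangle> \<cdot> m\<rangle> \<cdot> m)"
    by (simp only: eq)
  also have "\<dots> = f \<star> (g \<star> h)"
    by (simp add: mult)
  finally show ?thesis .
qed

lemma tangent_mult_p:
  assumes "f \<in> Ar X" "g \<in> Ar X" "Dom X f = Dom X g" "Cod X f = TO G" "Cod X g = TO G"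
  shows "f \<star> g \<cdot> \<p> G = \<langle>f \<cdot> \<p> G, g \<cdot> \<p> G\<rangle> \<cdot> m"
proof -
  have "f \<star> g \<cdot> \<p> G = T_pair G G f g \<cdot> (TA m \<cdot> \<p> G)"
    using assms by (simp add: tangent_mult_def Comp_assoc_arrow)
  also have "\<dots> = T_pair G G f g \<cdot> (\<p> (Prd X G G) \<cdot> m)"
    using p_naturality[of m] by simp
  also have "\<dots> = T_pair G G f g \<cdot> \<p> (Prd X G G) \<cdot> m"
    using assms by (simp add: Comp_assoc_arrow)
  also have "\<dots> = \<langle>f \<cdot> \<p> G, g \<cdot> \<p> G\<rangle> \<cdot> m"
    using assms by (simp add: T_pair_p)
  finally show ?thesis .
qed

lemma tangent_mult_zero:
  assumes "x \<in> Ar X" "y \<in> Ar X" "Dom X x = Dom X y" "Cod X x = G" "Cod X y = G"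
  shows "(x \<cdot> \<zero> G) \<star> (y \<cdot> \<zero> G) = \<langle>x, y\<rangle> \<cdot> m \<cdot> \<zero> G"
proof -
  have "(x \<cdot> \<zero> G) \<star> (y \<cdot> \<zero> G) = \<langle>x, y\<rangle> \<cdot> \<zero> (Prd X G G) \<cdot> TA m"
    using assms by (simp add: tangent_mult_def prod_pair_zero)
  also have "\<dots> = \<langle>x, y\<rangle> \<cdot> (m \<cdot> \<zero> G)"
    using assms zero_naturality[of m] by (simp add: Comp_assoc_arrow)
  also have "\<dots> = \<langle>x, y\<rangle> \<cdot> m \<cdot> \<zero> G"
    using assms by (simp add: Comp_assoc_arrow)
  finally show ?thesis .
qed

text \<open>Apply \<open>T\<close> to the left unit law of \<open>G\<close>: since \<open>T(1)\<close> is terminal, the first component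
  \<open>v T(!) T(u)\<close> is the zero vector \<open>0 T(u) = u 0\<close>.\<close>

lemma tangent_mult_unit_left:
  assumes v: "v \<in> hom X (One X) (TO G)"
  shows "(u \<cdot> \<zero> G) \<star> v = v"
proof -
  note [simp] = homD[OF v]
  have "v \<cdot> TA (bang X G) = \<zero> (One X)"
    by (rule into_T_One_eq[of _ "One X"]) (simp_all add: hom_def)
  moreover have "v \<cdot> TA (bang X G \<cdot> u) = v \<cdot> TA (bang X G) \<cdot> TA u"
    by (simp add: T_Comp Comp_assoc_arrow)
  ultimately have zero: "v \<cdot> TA (bang X G \<cdot> u) = u \<cdot> \<zero> G"
    using zero_naturality[of u] by simp
  have "v = v \<cdot> TA (\<langle>bang X G \<cdot> u, Id X G\<rangle> \<cdot> m)"
    by (simp add: unit_left T_Id)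
  also have "\<dots> = v \<cdot> TA \<langle>bang X G \<cdot> u, Id X G\<rangle> \<cdot> TA m"
    by (simp add: T_Comp Comp_assoc_arrow)
  also have "\<dots> = (v \<cdot> TA (bang X G \<cdot> u)) \<star> v"
    by (simp add: Comp_T_prod_pair tangent_mult_def T_Id)
  finally show ?thesis using zero by simp
qed

section \<open>Left-invariant vector fields and tangent vectors at the unit\<close>

lemma left_invariant_iff:
  "left_invariant_vector_field X G m \<xi> \<longleftrightarrow> \<xi> \<in> hom X G (TO G) \<and> \<xi> \<cdot> \<p> G = Id X G
     \<and> (Fst X G G \<cdot> \<zero> G) \<star> (Snd X G G \<cdot> \<xi>) = m \<cdot> \<xi>"
  by (auto simp: left_invariant_vector_field_def prod_map_def tangent_mult_def T_pair_def homD)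

text \<open>Left-invariance at the generalized elements \<open>1\<close> and \<open>! u\<close> of \<open>G\<close>, together with the
  right unit law.\<close>

lemma left_invariant_determined:
  assumes "left_invariant_vector_field X G m \<xi>"
  shows "\<zero> G \<star> (bang X G \<cdot> (u \<cdot> \<xi>)) = \<xi>"
proof -
  have inv: "(Fst X G G \<cdot> \<zero> G) \<star> (Snd X G G \<cdot> \<xi>) = m \<cdot> \<xi>"
    and [simp]: "\<xi> \<in> Ar X" "Dom X \<xi> = G" "Cod X \<xi> = TO G"
    using assms by (auto simp: left_invariant_iff homD)
  let ?w = "\<langle>Id X G, bang X G \<cdot> u\<rangle>"
  have "\<xi> = ?w \<cdot> m \<cdot> \<xi>"
    by (simp add: unit_right)
  also have "\<dots> = ?w \<cdot> ((Fst X G G \<cdot> \<zero> G) \<star> (Snd X G G \<cdot> \<xi>))"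
    by (simp add: inv Comp_assoc_arrow)
  also have "\<dots> = (?w \<cdot> Fst X G G \<cdot> \<zero> G) \<star> (?w \<cdot> Snd X G G \<cdot> \<xi>)"
    by (simp add: Comp_tangent_mult Comp_assoc_arrow del: prod_pair_projections)
  also have "\<dots> = \<zero> G \<star> (bang X G \<cdot> (u \<cdot> \<xi>))"
    by (simp add: Comp_assoc_arrow)
  finally show ?thesis by simp
qed

lemma left_invariant_translate:
  assumes v: "v \<in> hom X (One X) (TO G)" and vp: "v \<cdot> \<p> G = u"
  shows "left_invariant_vector_field X G m (\<zero> G \<star> (bang X G \<cdot> v))"
  unfolding left_invariant_iff
proof (intro conjI)
  note [simp] = homD[OF v]
  let ?\<xi> = "\<zero> G \<star> (bang X G \<cdot> v)" and ?F = "Fst X G G" and ?S = "Snd X G G"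
  show "?\<xi> \<in> hom X G (TO G)"
    by (simp add: hom_def)
  show "?\<xi> \<cdot> \<p> G = Id X G"
    by (simp add: tangent_mult_p zero_p Comp_assoc_arrow vp unit_right)
  have pull: "x \<cdot> ?\<xi> = (x \<cdot> \<zero> G) \<star> (bang X (Dom X x) \<cdot> v)" if "x \<in> Ar X" "Cod X x = G" for x
    using that by (simp add: Comp_tangent_mult Comp_bang flip: Comp_assoc_arrow)
  have "\<langle>?F, ?S\<rangle> = Id X (Prd X G G)"
    using Comp_Prd_eta[of "Id X (Prd X G G)" G G] by simp
  then have "m \<cdot> \<zero> G = (?F \<cdot> \<zero> G) \<star> (?S \<cdot> \<zero> G)"
    by (simp add: tangent_mult_zero)
  then have "m \<cdot> ?\<xi> = (?F \<cdot> \<zero> G) \<star> (?S \<cdot> \<zero> G) \<star> (bang X (Prd X G G) \<cdot> v)"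
    by (simp add: pull)
  also have "\<dots> = (?F \<cdot> \<zero> G) \<star> ((?S \<cdot> \<zero> G) \<star> (bang X (Prd X G G) \<cdot> v))"
    by (rule tangent_mult_assoc) simp_all
  finally show "(?F \<cdot> \<zero> G) \<star> (?S \<cdot> ?\<xi>) = m \<cdot> ?\<xi>"
    by (simp add: pull)
qed

lemma translate_at_unit:
  assumes v: "v \<in> hom X (One X) (TO G)"
  shows "u \<cdot> (\<zero> G \<star> (bang X G \<cdot> v)) = v"
proof -
  note [simp] = homD[OF v]
  have "u \<cdot> (bang X G \<cdot> v) = v"
    by (simp add: Comp_bang bang_One flip: Comp_assoc_arrow)
  then show ?thesis by (simp add: Comp_tangent_mult tangent_mult_unit_left[OF v])
qed

lemma bij_betw_left_invariant_at_unit: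
  "bij_betw (\<lambda>\<xi>. u \<cdot> \<xi>) {\<xi>. left_invariant_vector_field X G m \<xi>}
     {v \<in> hom X (One X) (TO G). v \<cdot> \<p> G = u}"
proof (rule bij_betw_byWitness[where f' = "\<lambda>v. \<zero> G \<star> (bang X G \<cdot> v)"])
  have "u \<cdot> \<xi> \<in> hom X (One X) (TO G) \<and> u \<cdot> \<xi> \<cdot> \<p> G = u"
    if "left_invariant_vector_field X G m \<xi>" for \<xi>
    using that Comp_hom[OF u_hom] by (auto simp: left_invariant_iff Comp_assoc_arrow homD)
  then show "(\<lambda>\<xi>. u \<cdot> \<xi>) ` {\<xi>. left_invariant_vector_field X G m \<xi>}
      \<subseteq> {v \<in> hom X (One X) (TO G). v \<cdot> \<p> G = u}"
    by auto
qed (auto simp: left_invariant_determined translate_at_unit left_invariant_translate)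

end

theorem proposition8:
  fixes X :: "('o, 'm, 'x) cartesian_tangent_data_scheme"
    and G TGu :: 'o and m u \<iota> a b :: 'm
  assumes "cartesian_tangent_category X"
    and "group_object X G m u \<iota>"
    and "is_pullback X TGu a b (Tproj X G) u"
  shows "\<exists>\<Phi>. bij_betw \<Phi> {\<xi>. left_invariant_vector_field X G m \<xi>} (elements X TGu)"
proof -
  interpret tangent_group_object X G m u \<iota>
    using assms(1,2) by (simp add: tangent_group_object_def)
  let ?over_u = "{v \<in> hom X (One X) (Tobj X G). Comp X v (Tproj X G) = u}"
  have "bij_betw (\<lambda>V. Comp X V a) (elements X TGu) ?over_u"
    using bij_betw_pullback_elements[OF One_terminal u_hom assms(3)]
    by (simp add: elements_def)
  from bij_betw_trans[OF bij_betw_left_invariant_at_unit bij_betw_inv_into[OF this]]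
  show ?thesis by blast
qed

end
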